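(* Let $p\in\mathbb{N}$ and suppose that the function $g\colon\mathbb{R}_+\to\mathbb{R}$ is eventually $p$-convex or eventually $p$-concave and has the asymptotic property that the sequence $n\mapsto\Delta^p g(n)$ (over positive integers $n$) converges to zero. Then there exists a unique (up to an additive constant) eventually $p$-convex or eventually $p$-concave solution $f\colon\mathbb{R}_+\to\mathbb{R}$ to the difference equation $\Delta f=g$ on $\mathbb{R}_+$. Moreover, $$f(x)=f(1)+\lim_{n\to\infty}f^p_n[g](x),\qquad x>0,$$ and $f$ is $p$-convex (resp. $p$-concave) on any unbounded subinterval of $\mathbb{R}_+$ on which $g$ is $p$-concave (resp. $p$-convex).
   Context: $\mathbb{N}=\{0,1,2,\ldots\}$, $\mathbb{N}^*=\{1,2,\ldots\}$, $\mathbb{R}_+=(0,\infty)$, and $\Delta f(x)=f(x+1)-f(x)$. For an integer $p\ge -1$, a function $f\colon I\to\mathbb{R}$ on a real interval $I$ with nonempty interior is $p$-convex (resp. $p$-concave) if for all $x_0<x_1<\cdots<x_{p+1}$ in $I$ the divided difference $f[x_0,\ldots,x_{p+1}]$ is $\ge 0$ (resp. $\le 0$), where $f[x_0,\ldots,x_n]=\sum_{k=0}^n f(x_k)/\prod_{j\ne k}(x_k-x_j)$ for pairwise distinct points. A function on $\mathbb{R}_+$ is eventually $p$-convex (resp. eventually $p$-concave) if it is so on some neighborhood $[a,\infty)$ of infinity. For $p\in\mathbb{N}$, $n\in\mathbb{N}^*$ and $g\colon\mathbb{R}_+\to\mathbb{R}$, $$f^p_n[g](x)=-g(x)+\sum_{k=1}^{n-1}(g(k)-g(x+k))+\sum_{j=1}^p\binom{x}{j}\Delta^{j-1}g(n),\qquad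 x>0.$$ *)

theory Defs
  imports "HOL-Analysis.Analysis"
begin

text \<open>Functions on \<open>\<real>\<^sub>+\<close> are represented by total functions \<open>real \<Rightarrow> real\<close> of which only the values
  on \<open>{0<..}\<close> matter.\<close>

definition Delta :: "(real \<Rightarrow> real) \<Rightarrow> real \<Rightarrow> real" where
  "Delta f x = f (x + 1) - f x"

text \<open>\<open>div_diff f x n\<close> is \<open>f[x 0, \<dots>, x n]\<close>, meant for pairwise distinct points \<open>x 0, \<dots>, x n\<close>.\<close>

definition div_diff :: "(real \<Rightarrow> real) \<Rightarrow> (nat \<Rightarrow> real) \<Rightarrow> nat \<Rightarrow> real" where
  "div_diff f x n = (\<Sum>k\<le>n. f (x k) / (\<Prod>j\<in>{..n} - {k}. x k - x j))"

text \<open>The order \<open>p\<close> is an integer with \<open>p \<ge> -1\<close>, and \<open>I\<close> is an interval with nonempty interior;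
  \<open>nat (p + 1)\<close> is the index of the last point.\<close>

definition p_convex_on :: "int \<Rightarrow> real set \<Rightarrow> (real \<Rightarrow> real) \<Rightarrow> bool" where
  "p_convex_on p I f \<longleftrightarrow>
    (\<forall>x :: nat \<Rightarrow> real. x ` {..nat (p + 1)} \<subseteq> I \<longrightarrow> strict_mono_on {..nat (p + 1)} x \<longrightarrow>
       div_diff f x (nat (p + 1)) \<ge> 0)"

definition p_concave_on :: "int \<Rightarrow> real set \<Rightarrow> (real \<Rightarrow> real) \<Rightarrow> bool" where
  "p_concave_on p I f \<longleftrightarrow>
    (\<forall>x :: nat \<Rightarrow> real. x ` {..nat (p + 1)} \<subseteq> I \<longrightarrow> strict_mono_on {..nat (p + 1)} x \<longrightarrow>
       div_diff f x (nat (p + 1)) \<le> 0)"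

definition eventually_p_convex :: "int \<Rightarrow> (real \<Rightarrow> real) \<Rightarrow> bool" where
  "eventually_p_convex p f \<longleftrightarrow> (\<exists>a>0. p_convex_on p {a..} f)"

definition eventually_p_concave :: "int \<Rightarrow> (real \<Rightarrow> real) \<Rightarrow> bool" where
  "eventually_p_concave p f \<longleftrightarrow> (\<exists>a>0. p_concave_on p {a..} f)"

text \<open>\<open>f_seq p n g x\<close> is \<open>f\<^sup>p\<^sub>n[g](x)\<close>, for \<open>n \<ge> 1\<close> and \<open>x > 0\<close>.\<close>

definition f_seq :: "nat \<Rightarrow> nat \<Rightarrow> (real \<Rightarrow> real) \<Rightarrow> real \<Rightarrow> real" where
  "f_seq p n g x =
     - g x + (\<Sum>k=1..<n. g (real k) - g (x + real k))
     + (\<Sum>j=1..p. (x gchoose j) * (Delta ^^ (j - 1)) g (real n))"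

definition admissible_solution :: "nat \<Rightarrow> (real \<Rightarrow> real) \<Rightarrow> (real \<Rightarrow> real) \<Rightarrow> bool" where
  "admissible_solution p g f \<longleftrightarrow>
     (\<forall>x>0. Delta f x = g x) \<and>
     (eventually_p_convex (int p) f \<or> eventually_p_concave (int p) f)"

end

theory Submission
  imports Defs
begin

text \<open>
  Everything rests on the error \<open>R\<^sub>n[h](x)\<close> made at \<open>n + x\<close> by the polynomial that interpolates a
  function \<open>h\<close> at \<open>n, n + 1, \<dots>, n + p\<close> (\<open>newton_remainder (Suc p)\<close> below). It links the
  approximating sequence to the difference equation in two ways.

  Consecutive terms of the sequence differ by \<open>- R\<^sub>n[g](x)\<close> (\<open>f_seq_Suc\<close>); and if \<open>\<Delta> f = g\<close>, then
  the terms are \<open>f(x) - f(1) - R\<^sub>n[f](x)\<close> (\<open>f_seq_of_solution\<close>). So existence amounts to the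
  summability of \<open>R\<^sub>n[g](x)\<close> over \<open>n\<close>, and the limit formula, hence uniqueness, to \<open>R\<^sub>n[f](x) \<rightarrow> 0\<close>.

  Both follow from one estimate (\<open>newton_remainder_bound\<close>). The error \<open>R\<^sub>n[h](x)\<close> is a product of
  linear factors times the divided difference of \<open>h\<close> at \<open>n, \<dots>, n + p, n + x\<close>. If \<open>h\<close> is
  \<open>p\<close>-convex near infinity, its divided differences of order \<open>p\<close> increase with every node, which
  squeezes \<open>\<bar>R\<^sub>n[h](x)\<bar>\<close>, for large \<open>n\<close>, below \<open>\<Delta>\<^sup>p h(n + N) - \<Delta>\<^sup>p h(n)\<close> times a factor that depends
  on \<open>x\<close> and \<open>p\<close> only; here \<open>N \<ge> 1\<close> is any fixed integer with \<open>N + p \<ge> x\<close>. For \<open>h = g\<close> these differences are summable because \<open>\<Delta>\<^sup>p g(n)\<close> converges;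
  for \<open>h = f\<close> each is a sum of \<open>N\<close> values of \<open>\<Delta>\<^sup>p\<^sup>+\<^sup>1 f = \<Delta>\<^sup>p g\<close>, which tend to zero. The concave case
  is the convex one for \<open>- h\<close>.

  Finally, a divided difference at \<open>p + 2\<close> nodes annihilates the polynomials of degree at most \<open>p\<close>,
  so it sees in the approximating sequence only a sum of translates of \<open>- g\<close> (\<open>dd_f_seq\<close>). The
  limit therefore has the opposite convexity to \<open>g\<close> wherever translation to the right stays
  inside the interval.
\<close>

section \<open>Divided differences over finite sets\<close>

text \<open>A divided difference does not depend on the order of its nodes, so it is attached here to the
  finite set of nodes. Nodes can then be inserted and removed without renumbering.\<close>

definition dd :: "(real \<Rightarrow> real) \<Rightarrow> real set \<Rightarrow> real" where
  "dd f S = (\<Sum>k\<in>S. f k / (\<Prod>j\<in>S - {k}. k - j))"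

lemma div_diff_eq_dd:
  assumes "inj_on x {..n}"
  shows "div_diff f x n = dd f (x ` {..n})"
proof -
  have "(\<Prod>j\<in>x ` {..n} - {x k}. x k - j) = (\<Prod>j\<in>{..n} - {k}. x k - x j)" if "k \<le> n" for k
  proof -
    have "x ` {..n} - {x k} = x ` ({..n} - {k})"
      using assms that by (auto simp: inj_on_def)
    moreover have "inj_on x ({..n} - {k})"
      using assms by (rule inj_on_subset) auto
    ultimately show ?thesis
      by (simp add: prod.reindex)
  qed
  then show ?thesis
    unfolding dd_def div_diff_def by (simp add: sum.reindex[OF assms])
qed

lemma dd_add: "dd (\<lambda>x. f x + g x) S = dd f S + dd g S"
  unfolding dd_def by (simp add: add_divide_distrib sum.distrib)

lemma dd_cmult: "dd (\<lambda>x. c * f x) S = c * dd f S"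
  unfolding dd_def by (simp add: sum_distrib_left)

lemma dd_minus: "dd (\<lambda>x. - f x) S = - dd f S"
  using dd_cmult[of "-1" f S] by simp

lemma dd_diff: "dd (\<lambda>x. f x - g x) S = dd f S - dd g S"
  using dd_add[of f "\<lambda>x. - g x" S] by (simp add: dd_minus)

lemma dd_sum: "dd (\<lambda>x. \<Sum>i\<in>A. f i x) S = (\<Sum>i\<in>A. dd (f i) S)"
  unfolding dd_def by (subst sum.swap) (simp add: sum_divide_distrib)

lemma dd_shift: "dd (\<lambda>x. f (x + c)) S = dd f ((\<lambda>x. x + c) ` S)"
proof -
  have "(\<Prod>j\<in>(\<lambda>x. x + c) ` S - {k + c}. k + c - j) = (\<Prod>j\<in>S - {k}. k - j)" for k
  proof -
    have "(\<lambda>x. x + c) ` S - {k + c} = (\<lambda>x. x + c) ` (S - {k})"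
      by auto
    then show ?thesis
      by (simp add: prod.reindex)
  qed
  then show ?thesis
    unfolding dd_def by (simp add: sum.reindex)
qed

lemma dd_tendsto:
  assumes "\<And>x. x \<in> S \<Longrightarrow> (\<lambda>n. F n x) \<longlonglongrightarrow> f x"
  shows "(\<lambda>n. dd (F n) S) \<longlonglongrightarrow> dd f S"
  unfolding dd_def divide_inverse by (intro tendsto_sum tendsto_mult tendsto_const assms)

lemma dd_insert:
  assumes "finite S" "a \<notin> S"
  shows "dd f (insert a S) =
    f a / (\<Prod>j\<in>S. a - j) + (\<Sum>k\<in>S. f k / ((k - a) * (\<Prod>j\<in>S - {k}. k - j)))"
proof -
  have "(\<Prod>j\<in>insert a S - {k}. k - j) = (k - a) * (\<Prod>j\<in>S - {k}. k - j)" if "k \<in> S" for k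
  proof -
    have "insert a S - {k} = insert a (S - {k})" "a \<notin> S - {k}" "finite (S - {k})"
      using that assms by auto
    then show ?thesis
      by (metis prod.insert)
  qed
  then show ?thesis
    unfolding dd_def using assms by simp
qed

text \<open>The recursion for divided differences: up to the factor \<open>a - b\<close>, the one of
  higher order measures how the lower one reacts when one node moves from \<open>b\<close> to \<open>a\<close>. Positivity at
  one order thus becomes monotonicity in the nodes at the order below.\<close>

lemma dd_exchange:
  assumes "finite S" "a \<notin> S" "b \<notin> S" "a \<noteq> b"
  shows "dd f (insert a S) - dd f (insert b S) = (a - b) * dd f (insert a (insert b S))"
proof -
  let ?P = "\<lambda>k. \<Prod>j\<in>S - {k}. k - j"
  have *: "(\<Prod>j\<in>insert b S - {k}. k - j) = (k - b) * ?P k" if "k \<in> S" for k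
  proof -
    have "insert b S - {k} = insert b (S - {k})" "b \<notin> S - {k}" "finite (S - {k})"
      using that assms by auto
    then show ?thesis
      by (metis prod.insert)
  qed
  have ins: "insert b S - {b} = S"
    using assms by auto
  have "(a - b) * dd f (insert a (insert b S)) =
      (a - b) * (f a / ((a - b) * (\<Prod>j\<in>S. a - j)))
      + (a - b) * (f b / ((b - a) * (\<Prod>j\<in>S. b - j)))
      + (\<Sum>k\<in>S. (a - b) * (f k / ((k - a) * ((k - b) * ?P k))))"
    using assms by (simp add: dd_insert * ins sum_distrib_left distrib_left)
  also have "(\<Sum>k\<in>S. (a - b) * (f k / ((k - a) * ((k - b) * ?P k)))) =
      (\<Sum>k\<in>S. f k / ((k - a) * ?P k)) - (\<Sum>k\<in>S. f k / ((k - b) * ?P k))"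
    unfolding sum_subtractf[symmetric]
  proof (rule sum.cong[OF refl])
    fix k assume k: "k \<in> S"
    have "k - a \<noteq> 0" "k - b \<noteq> 0"
      using k assms by auto
    moreover have "?P k \<noteq> 0"
      using assms(1) by simp
    ultimately show "(a - b) * (f k / ((k - a) * ((k - b) * ?P k))) =
        f k / ((k - a) * ?P k) - f k / ((k - b) * ?P k)"
      by (simp add: divide_simps) (simp add: algebra_simps)
  qed
  also have "(a - b) * (f a / ((a - b) * (\<Prod>j\<in>S. a - j))) = f a / (\<Prod>j\<in>S. a - j)"
    using assms(4) by simp
  also have "(a - b) * (f b / ((b - a) * (\<Prod>j\<in>S. b - j))) = - (f b / (\<Prod>j\<in>S. b - j))"
  proof -
    have "(a - b) / (b - a) = -1"
      using assms(4) by (simp add: divide_simps)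
    then have "(a - b) / (b - a) * (f b / (\<Prod>j\<in>S. b - j)) = - (f b / (\<Prod>j\<in>S. b - j))"
      by simp
    then show ?thesis
      by (simp add: times_divide_times_eq)
  qed
  finally show ?thesis
    using assms by (simp add: dd_insert)
qed

lemma dd_const:
  assumes "finite S" "card S \<ge> 2"
  shows "dd (\<lambda>x. c) S = 0"
proof -
  have "dd (\<lambda>x. c) S = 0" if "finite S" "card S = n + 2" for S n
    using that
  proof (induction n arbitrary: S)
    case 0
    then obtain a b where "S = {a, b}" "a \<noteq> b"
      by (auto simp: card_2_iff numeral_2_eq_2[symmetric])
    moreover have "dd (\<lambda>x. c) {a} - dd (\<lambda>x. c) {b} = 0"
      by (simp add: dd_def)
    ultimately show ?case
      using dd_exchange[of "{}" a b "\<lambda>x. c"] by simp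
  next
    case (Suc n)
    obtain a T where a: "S = insert a T" "a \<notin> T" "card T = n + 2"
      using Suc.prems by (metis add_Suc card_Suc_eq)
    then obtain b U where b: "T = insert b U" "b \<notin> U" "card U = Suc n"
      by (metis add_2_eq_Suc' card_Suc_eq)
    have fin: "finite U"
      using Suc.prems a b by auto
    have "dd (\<lambda>x. c) (insert a U) = 0" "dd (\<lambda>x. c) (insert b U) = 0"
      using Suc.IH a b fin by auto
    then show ?case
      using dd_exchange[of U a b "\<lambda>x. c"] a b fin by auto
  qed
  from this[of S "card S - 2"] show ?thesis
    using assms by simp
qed

text \<open>The factor \<open>x - c\<close> kills the term of the node \<open>c\<close> and cancels in the denominators of the
  others.\<close>

lemma dd_times_linear:
  assumes "finite S" "c \<in> S"
  shows "dd (\<lambda>x. (x - c) * h x) S = dd h (S - {c})"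
proof -
  have "S = insert c (S - {c})"
    using assms by auto
  then have "dd (\<lambda>x. (x - c) * h x) S = dd (\<lambda>x. (x - c) * h x) (insert c (S - {c}))"
    by simp
  also have "\<dots> = dd h (S - {c})"
    by (subst dd_insert) (auto simp: dd_def assms intro: sum.cong)
  finally show ?thesis .
qed

lemma gbinomial_times_diff: "(x - real k) * (x gchoose k) = real (Suc k) * (x gchoose Suc k)"
  using gbinomial_absorb_comp[of x k] gbinomial_absorption[of k x] by simp

text \<open>The polynomial \<open>x gchoose j\<close> has degree \<open>j\<close>, so its divided differences over more than
  \<open>j + 1\<close> nodes vanish. Writing the next linear factor \<open>x - j\<close> as \<open>(x - c) + (c - j)\<close> for a node
  \<open>c\<close> gives an induction on \<open>j\<close>.\<close>

lemma dd_gbinomial: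
  assumes "finite S" "card S \<ge> j + 2"
  shows "dd (\<lambda>x. x gchoose j) S = 0"
  using assms
proof (induction j arbitrary: S)
  case 0
  then show ?case
    by (simp add: dd_const)
next
  case (Suc j)
  obtain c where c: "c \<in> S"
    using Suc.prems by fastforce
  have "real (Suc j) * dd (\<lambda>x. x gchoose Suc j) S = dd (\<lambda>x. real (Suc j) * (x gchoose Suc j)) S"
    by (simp only: dd_cmult)
  also have "\<dots> = dd (\<lambda>x. (x - c) * (x gchoose j) + (c - real j) * (x gchoose j)) S"
    by (simp only: gbinomial_times_diff[symmetric]) (simp add: algebra_simps)
  also have "\<dots> = dd (\<lambda>x. x gchoose j) (S - {c}) + (c - real j) * dd (\<lambda>x. x gchoose j) S"
    by (simp only: dd_add dd_cmult dd_times_linear[OF Suc.prems(1) c])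
  also have "\<dots> = 0"
    using Suc c by simp
  finally show ?case
    by simp
qed

section \<open>Forward differences and Newton interpolation\<close>

lemma Delta_pow_Suc: "(Delta ^^ Suc j) g a = (Delta ^^ j) g (a + 1) - (Delta ^^ j) g a"
  by (simp add: Delta_def)

lemma Delta_pow_cong:
  assumes "\<And>x. x > 0 \<Longrightarrow> u x = v x" "a > 0"
  shows "(Delta ^^ j) u a = (Delta ^^ j) v a"
  using assms(2)
  by (induction j arbitrary: a) (auto simp: Delta_def assms(1))

lemma Delta_pow_minus: "(Delta ^^ j) (\<lambda>x. - g x) a = - (Delta ^^ j) g a"
  by (induction j arbitrary: a) (auto simp: Delta_def)

lemma Delta_pow_solution:
  assumes "\<And>x. x > 0 \<Longrightarrow> Delta f x = g x" "a > 0"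
  shows "(Delta ^^ Suc j) f a = (Delta ^^ j) g a"
proof -
  have "(Delta ^^ Suc j) f = (Delta ^^ j) (Delta f)"
    by (simp only: funpow_Suc_right comp_apply)
  then show ?thesis
    using Delta_pow_cong[of "Delta f" g, OF assms] by simp
qed

definition nodes :: "real \<Rightarrow> nat \<Rightarrow> real set" where
  "nodes a p = (\<lambda>i. a + real i) ` {..<p}"

lemma finite_nodes [simp]: "finite (nodes a p)"
  by (simp add: nodes_def)

lemma card_nodes [simp]: "card (nodes a p) = p"
  by (simp add: nodes_def card_image inj_on_def)

lemma nodes_Suc: "nodes a (Suc p) = insert (a + real p) (nodes a p)"
  by (simp add: nodes_def lessThan_Suc)

lemma nodes_Suc_shift: "nodes a (Suc p) = insert a (nodes (a + 1) p)"
  unfolding nodes_def lessThan_Suc_eq_insert_0 by (auto simp: image_iff)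

lemma dd_nodes: "dd g (nodes a (Suc p)) = (Delta ^^ p) g a / fact p"
proof (induction p arbitrary: a)
  case 0
  then show ?case
    by (simp add: nodes_def dd_def lessThan_Suc)
next
  case (Suc p)
  let ?T = "nodes (a + 1) p"
  have out: "a + 1 + real p \<notin> ?T" "a \<notin> ?T"
    by (auto simp: nodes_def)
  have "nodes a (Suc (Suc p)) = insert (a + 1 + real p) (insert a ?T)"
    by (subst nodes_Suc_shift, subst nodes_Suc) auto
  then have "(1 + real p) * dd g (nodes a (Suc (Suc p))) =
      dd g (insert (a + 1 + real p) ?T) - dd g (insert a ?T)"
    using dd_exchange[of ?T "a + 1 + real p" a g] out by simp
  also have "\<dots> = (Delta ^^ Suc p) g a / fact p"
    unfolding nodes_Suc[symmetric] nodes_Suc_shift[symmetric] Suc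
    by (simp add: Delta_pow_Suc diff_divide_distrib del: funpow.simps)
  finally have eq: "(1 + real p) * dd g (nodes a (Suc (Suc p))) = (Delta ^^ Suc p) g a / fact p" .
  have "dd g (nodes a (Suc (Suc p))) = ((1 + real p) * dd g (nodes a (Suc (Suc p)))) / (1 + real p)"
    by simp
  then show ?case
    unfolding eq by (simp add: mult.commute del: funpow.simps)
qed

text \<open>The error at \<open>a + x\<close> of the polynomial that interpolates \<open>g\<close> at the \<open>p\<close> nodes
  \<open>a, a + 1, \<dots>, a + p - 1\<close>, in Newton's forward difference form.\<close>

definition newton_remainder :: "nat \<Rightarrow> real \<Rightarrow> (real \<Rightarrow> real) \<Rightarrow> real \<Rightarrow> real" where
  "newton_remainder p a g x = g (x + a) - (\<Sum>j<p. (x gchoose j) * (Delta ^^ j) g a)"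

lemma newton_remainder_Suc:
  "newton_remainder (Suc p) a g x = newton_remainder p a g x - (x gchoose p) * (Delta ^^ p) g a"
  by (simp add: newton_remainder_def)

lemma newton_remainder_minus: "newton_remainder p a (\<lambda>x. - g x) x = - newton_remainder p a g x"
  by (simp add: newton_remainder_def Delta_pow_minus sum_negf)

text \<open>The error formula of Newton interpolation; \<open>fact p * (x gchoose p)\<close> is the product
  \<open>x (x - 1) \<dots> (x - p + 1)\<close> of the differences between \<open>a + x\<close> and the nodes.\<close>

lemma newton_remainder_eq_dd:
  assumes "x \<notin> real ` {..<p}"
  shows "newton_remainder p a g x = fact p * (x gchoose p) * dd g (insert (a + x) (nodes a p))"
  using assms
proof (induction p)
  case 0
  then show ?case
    by (simp add: newton_remainder_def nodes_def dd_def add.commute)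
next
  case (Suc p)
  let ?S = "nodes a p"
  have x: "x \<notin> real ` {..<p}" "x \<noteq> real p"
    using Suc.prems by (auto simp: image_iff)
  have out: "a + x \<notin> ?S" "a + real p \<notin> ?S"
    using x by (auto simp: nodes_def image_iff)
  have "newton_remainder (Suc p) a g x =
      fact p * (x gchoose p) * (dd g (insert (a + x) ?S) - (Delta ^^ p) g a / fact p)"
    by (simp add: newton_remainder_Suc Suc.IH[OF x(1)] right_diff_distrib)
  also have "\<dots> = fact p * (x gchoose p) * (dd g (insert (a + x) ?S) - dd g (insert (a + real p) ?S))"
    by (simp add: dd_nodes[symmetric] nodes_Suc)
  also have "\<dots> = fact p * ((x - real p) * (x gchoose p)) * dd g (insert (a + x) (nodes a (Suc p)))"
    using dd_exchange[of ?S "a + x" "a + real p" g] out x by (simp add: nodes_Suc)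
  also have "fact p * ((x - real p) * (x gchoose p)) = fact (Suc p) * (x gchoose Suc p)"
    unfolding gbinomial_times_diff by simp
  finally show ?case .
qed

text \<open>Interpolation is exact at the nodes. The product formula does not cover them, because its
  divided difference would have a repeated node.\<close>

lemma newton_remainder_at_node:
  assumes "m < p"
  shows "newton_remainder p a g (real m) = 0"
  using assms
proof (induction p)
  case (Suc p)
  show ?case
  proof (cases "m < p")
    case True
    then have "real m gchoose p = 0"
      by (simp add: binomial_gbinomial[symmetric])
    then show ?thesis
      using Suc.IH True by (simp add: newton_remainder_Suc)
  next
    case False
    then have m: "m = p"
      using Suc.prems by simp
    have "insert (a + real m) (nodes a m) = nodes a (Suc m)"
      by (simp add: nodes_Suc)
    moreover have "real m \<notin> real ` {..<m}"
      by auto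
    ultimately have "newton_remainder m a g (real m) = (real m gchoose m) * (Delta ^^ m) g a"
      using newton_remainder_eq_dd[of "real m" m a g] by (simp add: dd_nodes)
    then show ?thesis
      by (simp add: newton_remainder_Suc m)
  qed
qed simp

section \<open>Higher order convexity\<close>

lemma p_convex_on_iff_dd:
  "p_convex_on (int p) I f \<longleftrightarrow> (\<forall>S\<subseteq>I. finite S \<longrightarrow> card S = p + 2 \<longrightarrow> dd f S \<ge> 0)"
proof -
  have nat: "nat (int p + 1) = Suc p"
    by simp
  show ?thesis
  proof
    assume conv: "p_convex_on (int p) I f"
    show "\<forall>S\<subseteq>I. finite S \<longrightarrow> card S = p + 2 \<longrightarrow> dd f S \<ge> 0"
    proof (intro allI impI)
      fix S assume S: "S \<subseteq> I" "finite S" "card S = p + 2"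
      let ?l = "sorted_list_of_set S"
      have len: "length ?l = Suc (Suc p)"
        using S by simp
      have mono: "strict_mono_on {..Suc p} (\<lambda>i. ?l ! i)"
        using len sorted_wrt_nth_less[OF strict_sorted_list_of_set[of S]]
        by (intro strict_mono_onI) auto
      have img: "(\<lambda>i. ?l ! i) ` {..Suc p} = S"
        using nth_image[of "length ?l" ?l] S len
        by (simp add: lessThan_Suc_atMost atLeast0LessThan)
      have "div_diff f (\<lambda>i. ?l ! i) (Suc p) \<ge> 0"
        using conv mono img S(1) unfolding p_convex_on_def nat by blast
      then show "dd f S \<ge> 0"
        using div_diff_eq_dd[OF strict_mono_on_imp_inj_on[OF mono], of f] img by simp
    qed
  next
    assume *: "\<forall>S\<subseteq>I. finite S \<longrightarrow> card S = p + 2 \<longrightarrow> dd f S \<ge> 0"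
    show "p_convex_on (int p) I f"
      unfolding p_convex_on_def nat
    proof (intro allI impI)
      fix x :: "nat \<Rightarrow> real"
      assume x: "x ` {..Suc p} \<subseteq> I" "strict_mono_on {..Suc p} x"
      have inj: "inj_on x {..Suc p}"
        using x(2) by (rule strict_mono_on_imp_inj_on)
      show "div_diff f x (Suc p) \<ge> 0"
        unfolding div_diff_eq_dd[OF inj] using * x(1) by (simp add: card_image[OF inj])
    qed
  qed
qed

lemma p_concave_on_iff_minus: "p_concave_on p I f \<longleftrightarrow> p_convex_on p I (\<lambda>x. - f x)"
  unfolding p_concave_on_def p_convex_on_def div_diff_def by (simp add: sum_negf)

lemma dd_mono_node:
  assumes "p_convex_on (int p) I f" "insert a (insert b T) \<subseteq> I" "finite T" "card T = p"
    and "a \<notin> T" "b \<notin> T" "a \<le> b"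
  shows "dd f (insert a T) \<le> dd f (insert b T)"
proof (cases "a = b")
  case False
  have "card (insert b (insert a T)) = p + 2"
    using assms False by simp
  then have "dd f (insert b (insert a T)) \<ge> 0"
    using assms unfolding p_convex_on_iff_dd by (metis finite_insert insert_commute)
  then show ?thesis
    using dd_exchange[of T b a f] assms False
    by (metis diff_ge_0_iff_ge mult_nonneg_nonneg)
qed simp

text \<open>Moving all nodes to the right increases the divided difference of a \<open>p\<close>-convex function.
  The nodes move one at a time, the largest first, so that they never collide; \<open>T\<close> holds the nodes
  that have already been moved.\<close>

lemma dd_mono_nodes:
  assumes "p_convex_on (int p) I f"
    and "strict_mono_on {..<k} x" "strict_mono_on {..<k} y" "\<And>i. i < k \<Longrightarrow> x i \<le> y i"
    and "finite T" "k + card T = Suc p" "x ` {..<k} \<subseteq> I" "y ` {..<k} \<subseteq> I" "T \<subseteq> I"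
    and "\<And>i t. i < k \<Longrightarrow> t \<in> T \<Longrightarrow> y i < t"
  shows "dd f (x ` {..<k} \<union> T) \<le> dd f (y ` {..<k} \<union> T)"
  using assms(2-)
proof (induction k arbitrary: T)
  case (Suc k)
  let ?R = "x ` {..<k} \<union> T"
  have xk: "x i < x k" and yk: "y i < y k" if "i < k" for i
    using that Suc.prems(1,2) by (auto simp: strict_mono_on_def)
  have le: "x i \<le> y i" if "i < Suc k" for i
    using that Suc.prems(3) by blast
  have xT: "x i < t" if "i < Suc k" "t \<in> T" for i t
    using le[OF that(1)] Suc.prems(9)[OF that] by linarith
  have out: "x k \<notin> ?R" "y k \<notin> ?R" "y k \<notin> T"
    using xk xT[of k] Suc.prems(9)[of k] le[of k] by fastforce+
  have inj: "inj_on x {..<k}"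
    by (rule strict_mono_on_imp_inj_on, rule monotone_on_subset[OF Suc.prems(1)]) auto
  have disj: "x ` {..<k} \<inter> T = {}"
    using xT by (force simp: less_Suc_eq)
  have card: "card ?R = p"
    using Suc.prems(4,5) disj by (simp add: card_Un_disjoint card_image[OF inj])
  have "dd f (x ` {..<Suc k} \<union> T) = dd f (insert (x k) ?R)"
    by (simp add: lessThan_Suc)
  also have "\<dots> \<le> dd f (insert (y k) ?R)"
    using Suc.prems card out le[of k]
    by (intro dd_mono_node[OF assms(1)]) auto
  also have "\<dots> = dd f (x ` {..<k} \<union> insert (y k) T)"
    by simp
  also have "\<dots> \<le> dd f (y ` {..<k} \<union> insert (y k) T)"
  proof (rule Suc.IH)
    show "strict_mono_on {..<k} x" "strict_mono_on {..<k} y"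
      using Suc.prems(1,2) by (auto intro: monotone_on_subset)
    show "k + card (insert (y k) T) = Suc p"
      using Suc.prems(4,5) out by simp
    show "y i < t" if "i < k" "t \<in> insert (y k) T" for i t
      using that yk Suc.prems(9)[of i t] by auto
  qed (use Suc.prems le in auto)
  also have "\<dots> = dd f (y ` {..<Suc k} \<union> T)"
    by (simp add: lessThan_Suc)
  finally show ?case .
qed simp

section \<open>The remainder for convex functions\<close>

text \<open>The divided difference \<open>D\<close> over \<open>n, n + 1, \<dots>, n + p, n + x\<close> is nonnegative, and by
  the exchange recursion the product \<open>x D\<close> is the increase of the divided difference of order \<open>p\<close> when
  \<open>n\<close> moves to \<open>n + x\<close> while \<open>n + 1, \<dots>, n + p\<close> stay. Moving all these nodes further, to
  \<open>n + N, \<dots>, n + N + p\<close>, can only enlarge it, and there it is again a forward difference.\<close>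

lemma newton_remainder_bound:
  assumes conv: "p_convex_on (int p) {a..} f"
    and "n \<ge> a" "x > 0" "N \<ge> 1" "x \<le> real (N + p)"
  shows "\<bar>newton_remainder (Suc p) n f x\<bar>
    \<le> \<bar>(x - 1) gchoose p\<bar> * ((Delta ^^ p) f (n + real N) - (Delta ^^ p) f n)"
proof (cases "x \<in> real ` {..<Suc p}")
  case True
  then obtain m where m: "x = real m" "m < Suc p"
    by auto
  then have "m \<ge> 1"
    using assms by simp
  then have "x - 1 = real (m - 1)" "m - 1 < p"
    using m by auto
  then have "(x - 1) gchoose p = 0"
    by (simp only: binomial_gbinomial[symmetric]) simp
  then show ?thesis
    using newton_remainder_at_node[OF m(2), of n f] m(1) by simp
next
  case False
  let ?T = "nodes (n + 1) p"
  let ?b = "n + real (N + p)"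
  define D where "D = dd f (insert (n + x) (nodes n (Suc p)))"
  have x_out: "n + x \<notin> nodes n (Suc p)"
    using False by (auto simp: nodes_def)
  then have out: "n + x \<notin> ?T" "n \<notin> ?T" "?b \<notin> ?T"
    using \<open>N \<ge> 1\<close> by (auto simp: nodes_Suc_shift) (auto simp: nodes_def)
  have sub: "insert (n + x) (nodes n (Suc p)) \<subseteq> {a..}" "?T \<subseteq> {a..}"
    using assms by (auto simp: nodes_def)
  have "card (insert (n + x) (nodes n (Suc p))) = p + 2"
    using x_out by simp
  then have D: "D \<ge> 0"
    using conv sub(1) unfolding p_convex_on_iff_dd D_def by (metis finite_insert finite_nodes)
  have "x * D = dd f (insert (n + x) ?T) - dd f (insert n ?T)"
    using dd_exchange[of ?T "n + x" n f] out \<open>x > 0\<close> by (simp add: D_def nodes_Suc_shift)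
  also have "dd f (insert n ?T) = (Delta ^^ p) f n / fact p"
    by (simp add: nodes_Suc_shift[symmetric] dd_nodes)
  also have "dd f (insert (n + x) ?T) \<le> dd f (insert ?b ?T)"
    using out assms sub by (intro dd_mono_node[OF conv]) auto
  also have "dd f (insert ?b ?T) = dd f ((\<lambda>i. n + 1 + real i) ` {..<p} \<union> {?b})"
    by (simp add: nodes_def)
  also have "\<dots> \<le> dd f ((\<lambda>i. n + real N + real i) ` {..<p} \<union> {?b})"
    using assms by (intro dd_mono_nodes[OF conv]) (auto intro!: strict_mono_onI)
  also have "\<dots> = (Delta ^^ p) f (n + real N) / fact p"
    unfolding dd_nodes[symmetric] nodes_Suc by (simp add: nodes_def add.assoc)
  finally have xD: "fact p * (x * D) \<le> (Delta ^^ p) f (n + real N) - (Delta ^^ p) f n"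
    by (simp add: diff_divide_distrib[symmetric] pos_le_divide_eq mult.commute)
  have "newton_remainder (Suc p) n f x = fact p * (real (Suc p) * (x gchoose Suc p)) * D"
    by (simp add: newton_remainder_eq_dd[OF False] D_def)
  also have "\<dots> = ((x - 1) gchoose p) * (fact p * (x * D))"
    by (simp only: gbinomial_absorption) simp
  finally have "\<bar>newton_remainder (Suc p) n f x\<bar> = \<bar>(x - 1) gchoose p\<bar> * (fact p * (x * D))"
    using D \<open>x > 0\<close> by (simp add: abs_mult)
  also have "\<dots> \<le> \<bar>(x - 1) gchoose p\<bar> * ((Delta ^^ p) f (n + real N) - (Delta ^^ p) f n)"
    using xD by (intro mult_left_mono) auto
  finally show ?thesis .
qed

lemma eventually_newton_remainder_bound:
  assumes "p_convex_on (int p) {a..} f" "x > 0"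
  obtains N where "\<forall>\<^sub>F n in sequentially. \<bar>newton_remainder (Suc p) (real n) f x\<bar>
    \<le> \<bar>(x - 1) gchoose p\<bar> * ((Delta ^^ p) f (real (n + N)) - (Delta ^^ p) f (real n))"
proof -
  obtain M where M: "x \<le> real M"
    using real_arch_simple by blast
  have "\<forall>\<^sub>F n in sequentially. \<bar>newton_remainder (Suc p) (real n) f x\<bar>
      \<le> \<bar>(x - 1) gchoose p\<bar> * ((Delta ^^ p) f (real (n + Suc M)) - (Delta ^^ p) f (real n))"
    using eventually_ge_at_top[of "nat \<lceil>a\<rceil>"]
  proof eventually_elim
    case (elim n)
    then have "real n \<ge> a"
      by linarith
    then show ?case
      using newton_remainder_bound[OF assms(1), of "real n" x "Suc M"] assms(2) M
      by (simp add: add_ac)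
  qed
  then show thesis
    by (rule that)
qed

lemma summable_shifted_differences:
  fixes u :: "nat \<Rightarrow> real"
  assumes "u \<longlonglongrightarrow> c"
  shows "summable (\<lambda>n. u (n + N) - u n)"
proof -
  have "u (n + N) - u n = (\<Sum>i<N. u (Suc n + i) - u (n + i))" for n
    using sum_lessThan_telescope[of "\<lambda>i. u (n + i)" N] by simp
  moreover have "summable (\<lambda>n. u (Suc n + i) - u (n + i))" for i
    using telescope_summable[OF LIMSEQ_ignore_initial_segment[OF assms, of i]] .
  ultimately show ?thesis
    by (simp add: summable_sum)
qed

text \<open>The bound telescopes: its sum over \<open>n\<close> is finite as soon as \<open>\<Delta>\<^sup>p f(n)\<close> converges.\<close>

lemma summable_newton_remainder:
  assumes "eventually_p_convex (int p) f \<or> eventually_p_concave (int p) f"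
    and "(\<lambda>n. (Delta ^^ p) f (real n)) \<longlonglongrightarrow> c" "x > 0"
  shows "summable (\<lambda>n. newton_remainder (Suc p) (real n) f x)"
proof -
  have convex: "summable (\<lambda>n. newton_remainder (Suc p) (real n) f x)"
    if convex: "eventually_p_convex (int p) f" and lim: "(\<lambda>n. (Delta ^^ p) f (real n)) \<longlonglongrightarrow> c" for f c
  proof -
    obtain a where "p_convex_on (int p) {a..} f"
      using convex by (auto simp: eventually_p_convex_def)
    then obtain N where N: "\<forall>\<^sub>F n in sequentially. \<bar>newton_remainder (Suc p) (real n) f x\<bar>
        \<le> \<bar>(x - 1) gchoose p\<bar> * ((Delta ^^ p) f (real (n + N)) - (Delta ^^ p) f (real n))"
      using eventually_newton_remainder_bound assms(3) by blast
    show ?thesis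
      by (rule summable_comparison_test_ev[OF _ summable_mult[OF summable_shifted_differences[OF lim]]])
        (use N in simp)
  qed
  show ?thesis
    using assms(1)
  proof
    assume "eventually_p_concave (int p) f"
    then have "eventually_p_convex (int p) (\<lambda>x. - f x)"
      by (simp add: eventually_p_convex_def eventually_p_concave_def p_concave_on_iff_minus)
    from convex[OF this, of "- c"] tendsto_minus[OF assms(2)] show ?thesis
      by (simp add: Delta_pow_minus newton_remainder_minus summable_minus_iff)
  qed (use convex assms(2) in blast)
qed

text \<open>The difference \<open>\<Delta>\<^sup>p f(n + N) - \<Delta>\<^sup>p f(n)\<close> in the bound is a sum of \<open>N\<close> consecutive values of
  \<open>\<Delta>\<^sup>p\<^sup>+\<^sup>1 f\<close>. These tend to zero for a solution \<open>f\<close>, for which \<open>\<Delta>\<^sup>p f(n)\<close> itself may diverge.\<close>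

lemma newton_remainder_tendsto_0:
  assumes "eventually_p_convex (int p) f \<or> eventually_p_concave (int p) f"
    and "(\<lambda>n. (Delta ^^ Suc p) f (real n)) \<longlonglongrightarrow> 0" "x > 0"
  shows "(\<lambda>n. newton_remainder (Suc p) (real n) f x) \<longlonglongrightarrow> 0"
proof -
  have convex: "(\<lambda>n. newton_remainder (Suc p) (real n) f x) \<longlonglongrightarrow> 0"
    if convex: "eventually_p_convex (int p) f" and lim: "(\<lambda>n. (Delta ^^ Suc p) f (real n)) \<longlonglongrightarrow> 0" for f
  proof -
    let ?u = "\<lambda>n. (Delta ^^ p) f (real n)"
    obtain a where "p_convex_on (int p) {a..} f"
      using convex by (auto simp: eventually_p_convex_def)
    then obtain N where N: "\<forall>\<^sub>F n in sequentially. \<bar>newton_remainder (Suc p) (real n) f x\<bar>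
        \<le> \<bar>(x - 1) gchoose p\<bar> * (?u (n + N) - ?u n)"
      using eventually_newton_remainder_bound assms(3) by blast
    have "?u (n + N) - ?u n = (\<Sum>i<N. (Delta ^^ Suc p) f (real (n + i)))" for n
      using sum_lessThan_telescope[of "\<lambda>i. ?u (n + i)" N]
      by (simp add: Delta_pow_Suc add_ac del: funpow.simps)
    moreover have "(\<lambda>n. \<Sum>i<N. (Delta ^^ Suc p) f (real (n + i))) \<longlonglongrightarrow> (\<Sum>i<N. 0)"
      by (intro tendsto_sum LIMSEQ_ignore_initial_segment[OF lim])
    ultimately have "(\<lambda>n. ?u (n + N) - ?u n) \<longlonglongrightarrow> 0"
      by (simp del: funpow.simps)
    then have "(\<lambda>n. \<bar>(x - 1) gchoose p\<bar> * (?u (n + N) - ?u n)) \<longlonglongrightarrow> 0"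
      by (rule tendsto_mult_right_zero)
    then show ?thesis
      by (rule Lim_null_comparison[rotated]) (simp only: real_norm_def N)
  qed
  show ?thesis
    using assms(1)
  proof
    assume "eventually_p_concave (int p) f"
    then have "eventually_p_convex (int p) (\<lambda>x. - f x)"
      by (simp add: eventually_p_convex_def eventually_p_concave_def p_concave_on_iff_minus)
    moreover have "(\<lambda>n. (Delta ^^ Suc p) (\<lambda>x. - f x) (real n)) \<longlonglongrightarrow> 0"
      using tendsto_minus[OF assms(2)] by (simp only: Delta_pow_minus minus_zero)
    ultimately have "(\<lambda>n. - newton_remainder (Suc p) (real n) f x) \<longlonglongrightarrow> 0"
      unfolding newton_remainder_minus[symmetric] by (rule convex)
    from tendsto_minus[OF this] show ?thesis
      by simp
  qed (use convex assms(2) in blast)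
qed

section \<open>The approximating sequence\<close>

lemma f_seq_altdef:
  "f_seq p n g x = - g x + (\<Sum>k=1..<n. g (real k) - g (x + real k))
     + (\<Sum>j<p. (x gchoose Suc j) * (Delta ^^ j) g (real n))"
  unfolding f_seq_def by (simp add: sum.atLeast1_atMost_eq)

lemma f_seq_minus: "f_seq p n (\<lambda>x. - g x) x = - f_seq p n g x"
  unfolding f_seq_altdef by (simp add: Delta_pow_minus sum_negf sum_subtractf)

lemma f_seq_Suc:
  assumes "n \<ge> 1"
  shows "f_seq p (Suc n) g x - f_seq p n g x = - newton_remainder (Suc p) (real n) g x"
proof -
  have shift: "(Delta ^^ j) g (real (Suc n)) = (Delta ^^ j) g (real n) + (Delta ^^ Suc j) g (real n)"
    for j
    by (simp add: Delta_pow_Suc add.commute del: funpow.simps)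
  show ?thesis
    unfolding f_seq_altdef newton_remainder_def shift sum.lessThan_Suc_shift
    using assms by (simp add: distrib_left sum.distrib del: funpow.simps)
qed

text \<open>By Pascal's rule the polynomial part turns into the interpolation polynomial of \<open>g\<close> at
  \<open>n, \<dots>, n + p - 1\<close>, while the sum telescopes. So \<open>f_seq p n g\<close> solves the difference equation up to
  an interpolation error of one order less.\<close>

lemma Delta_f_seq:
  assumes "n \<ge> 1"
  shows "f_seq p n g (x + 1) - f_seq p n g x = g x - newton_remainder p (real n) g x"
proof -
  have "(\<Sum>k=1..<n. g (x + real k) - g (x + 1 + real k)) = g (x + 1) - g (x + real n)"
    using sum_Suc_diff'[of 1 n "\<lambda>k. - g (x + real k)"] assms by (simp add: add_ac)
  then show ?thesis
    unfolding f_seq_altdef newton_remainder_def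
    by (simp add: gbinomial_Suc_Suc distrib_right sum.distrib sum_subtractf)
qed

text \<open>If \<open>g = \<Delta> f\<close>, both sums of values of \<open>g\<close> telescope to values of \<open>f\<close>, and the differences
  of \<open>g\<close> are differences of \<open>f\<close> of one order more.\<close>

lemma f_seq_of_solution:
  assumes eq: "\<And>x. x > 0 \<Longrightarrow> Delta f x = g x" and "n \<ge> 1" "x > 0"
  shows "f_seq p n g x = f x - f 1 - newton_remainder (Suc p) (real n) f x"
proof -
  have g: "g y = f (y + 1) - f y" if "y > 0" for y
    using eq[OF that] by (simp add: Delta_def)
  have 1: "(\<Sum>k=1..<n. g (real k)) = f (real n) - f 1"
    using sum_Suc_diff'[of 1 n "\<lambda>k. f (real k)"] assms(2) by (simp add: g add_ac)
  have 2: "(\<Sum>k=1..<n. g (x + real k)) = f (x + real n) - f (x + 1)"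
    using sum_Suc_diff'[of 1 n "\<lambda>k. f (x + real k)"] assms by (simp add: g add_ac)
  have 3: "(Delta ^^ Suc j) f (real n) = (Delta ^^ j) g (real n)" for j
    using assms by (intro Delta_pow_solution) auto
  show ?thesis
    unfolding f_seq_altdef newton_remainder_def sum.lessThan_Suc_shift 3 sum_subtractf 1 2
    using g[OF \<open>x > 0\<close>] by simp
qed

lemma convergent_f_seq:
  assumes "eventually_p_convex (int p) g \<or> eventually_p_concave (int p) g"
    and "(\<lambda>n. (Delta ^^ p) g (real n)) \<longlonglongrightarrow> 0" "x > 0"
  shows "convergent (\<lambda>n. f_seq p n g x)"
proof -
  let ?r = "\<lambda>n. newton_remainder (Suc p) (real (Suc n)) g x"
  have "f_seq p (Suc n) g x = f_seq p 1 g x - (\<Sum>k<n. ?r k)" for n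
  proof (induction n)
    case (Suc n)
    then show ?case
      using f_seq_Suc[of "Suc n" p g x] by simp
  qed simp
  moreover have "summable ?r"
    using summable_newton_remainder[OF assms]
      summable_Suc_iff[of "\<lambda>n. newton_remainder (Suc p) (real n) g x"] by blast
  then have "convergent (\<lambda>n. f_seq p 1 g x - (\<Sum>k<n. ?r k))"
    by (intro convergent_diff convergent_const) (simp add: summable_iff_convergent)
  ultimately have "convergent (\<lambda>n. f_seq p (Suc n) g x)"
    by presburger
  then show ?thesis
    using convergent_Suc_iff by blast
qed

text \<open>On a set of \<open>p + 2\<close> nodes the polynomial part of \<open>f_seq p n g\<close>, of degree at most \<open>p\<close> in
  \<open>x\<close>, is invisible. What remains is minus a sum of translates of \<open>g\<close>.\<close>

lemma dd_f_seq:
  assumes "finite S" "card S = p + 2"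
  shows "dd (f_seq p n g) S = - dd g S - (\<Sum>k=1..<n. dd g ((\<lambda>x. x + real k) ` S))"
proof -
  have "dd (f_seq p n g) S = dd (\<lambda>x. - g x) S
      + (\<Sum>k=1..<n. dd (\<lambda>x. g (real k)) S - dd (\<lambda>x. g (x + real k)) S)
      + (\<Sum>j<p. dd (\<lambda>x. (Delta ^^ j) g (real n) * (x gchoose Suc j)) S)"
    unfolding f_seq_altdef[abs_def] by (simp only: dd_add dd_diff dd_sum mult.commute)
  also have "\<dots> = - dd g S - (\<Sum>k=1..<n. dd g ((\<lambda>x. x + real k) ` S))"
    using assms by (simp add: dd_minus dd_const dd_cmult dd_gbinomial dd_shift sum_negf)
  finally show ?thesis .
qed

lemma p_concave_on_limit_f_seq:
  assumes "\<And>x k. x \<in> I \<Longrightarrow> x + real k \<in> I"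
    and "\<And>x. x \<in> I \<Longrightarrow> (\<lambda>n. f_seq p n g x) \<longlonglongrightarrow> f x"
    and "p_convex_on (int p) I g"
  shows "p_concave_on (int p) I f"
  unfolding p_concave_on_iff_minus p_convex_on_iff_dd
proof (intro allI impI)
  fix S assume S: "S \<subseteq> I" "finite S" "card S = p + 2"
  have pos: "dd g ((\<lambda>x. x + real k) ` S) \<ge> 0" for k
  proof -
    have "card ((\<lambda>x. x + real k) ` S) = p + 2"
      by (simp add: card_image S)
    moreover have "(\<lambda>x. x + real k) ` S \<subseteq> I"
      using S assms(1) by auto
    ultimately show ?thesis
      using assms(3) S by (simp add: p_convex_on_iff_dd)
  qed
  have "dd (f_seq p n g) S \<le> 0" for n
    unfolding dd_f_seq[OF S(2,3)]
    using pos[of 0] sum_nonneg[of "{1..<n}" "\<lambda>k. dd g ((\<lambda>x. x + real k) ` S)"] pos by simp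
  moreover have "(\<lambda>n. dd (f_seq p n g) S) \<longlonglongrightarrow> dd f S"
    using S assms(2) by (intro dd_tendsto) auto
  ultimately have "dd f S \<le> 0"
    by (meson LIMSEQ_le_const2)
  then show "0 \<le> dd (\<lambda>x. - f x) S"
    by (simp add: dd_minus)
qed

lemma p_convex_on_limit_f_seq:
  assumes "\<And>x k. x \<in> I \<Longrightarrow> x + real k \<in> I"
    and "\<And>x. x \<in> I \<Longrightarrow> (\<lambda>n. f_seq p n g x) \<longlonglongrightarrow> f x"
    and "p_concave_on (int p) I g"
  shows "p_convex_on (int p) I f"
proof -
  have "p_concave_on (int p) I (\<lambda>x. - f x)"
  proof (rule p_concave_on_limit_f_seq[OF assms(1)])
    show "(\<lambda>n. f_seq p n (\<lambda>x. - g x) x) \<longlonglongrightarrow> - f x" if "x \<in> I" for x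
      unfolding f_seq_minus by (intro tendsto_minus assms(2) that)
  qed (use assms(3) in \<open>simp_all add: p_concave_on_iff_minus\<close>)
  then show ?thesis
    by (simp add: p_concave_on_iff_minus)
qed

section \<open>Existence and uniqueness of the solution\<close>

lemma limit_f_seq_admissible:
  assumes "eventually_p_convex (int p) g \<or> eventually_p_concave (int p) g"
    and "(\<lambda>n. (Delta ^^ p) g (real n)) \<longlonglongrightarrow> 0"
    and lim: "\<And>x. x > 0 \<Longrightarrow> (\<lambda>n. f_seq p n g x) \<longlonglongrightarrow> f x"
  shows "admissible_solution p g f"
  unfolding admissible_solution_def
proof (intro conjI allI impI)
  fix x :: real assume x: "x > 0"
  have "(\<lambda>n. newton_remainder (Suc p) (real n) g x + (x gchoose p) * (Delta ^^ p) g (real n))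
      \<longlonglongrightarrow> 0 + (x gchoose p) * 0"
    using summable_LIMSEQ_zero[OF summable_newton_remainder[OF assms(1,2) x]] assms(2)
    by (intro tendsto_intros)
  then have "(\<lambda>n. g x - newton_remainder p (real n) g x) \<longlonglongrightarrow> g x - 0"
    unfolding newton_remainder_Suc by (intro tendsto_intros) simp
  moreover have "\<forall>\<^sub>F n in sequentially. g x - newton_remainder p (real n) g x =
      f_seq p n g (x + 1) - f_seq p n g x"
    using eventually_ge_at_top[of 1] by eventually_elim (simp add: Delta_f_seq)
  ultimately have "(\<lambda>n. f_seq p n g (x + 1) - f_seq p n g x) \<longlonglongrightarrow> g x"
    using tendsto_cong by fastforce
  moreover have "(\<lambda>n. f_seq p n g (x + 1) - f_seq p n g x) \<longlonglongrightarrow> f (x + 1) - f x"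
    using x by (intro tendsto_diff lim) auto
  ultimately show "Delta f x = g x"
    unfolding Delta_def by (rule LIMSEQ_unique[symmetric])
next
  have lim': "(\<lambda>n. f_seq p n g x) \<longlonglongrightarrow> f x" if "a > 0" "x \<in> {a..}" for a x
    using that by (intro lim) auto
  show "eventually_p_convex (int p) f \<or> eventually_p_concave (int p) f"
    using assms(1)
  proof
    assume "eventually_p_convex (int p) g"
    then obtain a where a: "a > 0" "p_convex_on (int p) {a..} g"
      by (auto simp: eventually_p_convex_def)
    have "p_concave_on (int p) {a..} f"
      by (rule p_concave_on_limit_f_seq[OF _ lim'[OF a(1)] a(2)]) auto
    then show ?thesis
      using a(1) by (auto simp: eventually_p_concave_def)
  next
    assume "eventually_p_concave (int p) g"
    then obtain a where a: "a > 0" "p_concave_on (int p) {a..} g"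
      by (auto simp: eventually_p_concave_def)
    have "p_convex_on (int p) {a..} f"
      by (rule p_convex_on_limit_f_seq[OF _ lim'[OF a(1)] a(2)]) auto
    then show ?thesis
      using a(1) by (auto simp: eventually_p_convex_def)
  qed
qed

lemma f_seq_tendsto_solution:
  assumes "admissible_solution p g f" "(\<lambda>n. (Delta ^^ p) g (real n)) \<longlonglongrightarrow> 0" "x > 0"
  shows "(\<lambda>n. f_seq p n g x) \<longlonglongrightarrow> f x - f 1"
proof -
  have eq: "Delta f y = g y" if "y > 0" for y
    using assms(1) that by (simp add: admissible_solution_def)
  have ev: "eventually_p_convex (int p) f \<or> eventually_p_concave (int p) f"
    using assms(1) by (simp add: admissible_solution_def)
  have "\<forall>\<^sub>F n in sequentially. (Delta ^^ p) g (real n) = (Delta ^^ Suc p) f (real n)"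
    using eventually_ge_at_top[of 1] by eventually_elim (simp only: Delta_pow_solution[OF eq] of_nat_0_less_iff)
  then have "(\<lambda>n. (Delta ^^ Suc p) f (real n)) \<longlonglongrightarrow> 0"
    using assms(2) tendsto_cong by fastforce
  then have "(\<lambda>n. f x - f 1 - newton_remainder (Suc p) (real n) f x) \<longlonglongrightarrow> f x - f 1 - 0"
    using newton_remainder_tendsto_0[OF ev _ assms(3)] by (intro tendsto_intros)
  moreover have "\<forall>\<^sub>F n in sequentially. f x - f 1 - newton_remainder (Suc p) (real n) f x = f_seq p n g x"
    using eventually_ge_at_top[of 1]
    by eventually_elim (simp add: f_seq_of_solution[OF eq _ assms(3)])
  ultimately show ?thesis
    using tendsto_cong by fastforce
qed

lemma unbounded_interval_closed_under_shift:
  fixes I :: "real set"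
  assumes "is_interval I" "I \<subseteq> {0<..}" "\<not> bounded I" "x \<in> I"
  shows "x + real k \<in> I"
proof -
  have "\<exists>z\<in>I. z > x + real k"
  proof (rule ccontr)
    assume "\<not> (\<exists>z\<in>I. z > x + real k)"
    then have "I \<subseteq> {0..x + real k}"
      using assms(2) by fastforce
    then show False
      using assms(3) bounded_subset[OF bounded_closed_interval] by blast
  qed
  then obtain z where "z \<in> I" "x + real k < z"
    by blast
  then show ?thesis
    using mem_is_interval_1_I[OF assms(1) assms(4)] by simp
qed

theorem theorem1p4:
  fixes p :: nat and g :: "real \<Rightarrow> real"
  assumes "eventually_p_convex (int p) g \<or> eventually_p_concave (int p) g"
    and "(\<lambda>n::nat. (Delta ^^ p) g (real n)) \<longlonglongrightarrow> 0"
  shows "(\<exists>f. admissible_solution p g f) \<and>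
    (\<forall>f\<^sub>1 f\<^sub>2. admissible_solution p g f\<^sub>1 \<longrightarrow> admissible_solution p g f\<^sub>2 \<longrightarrow>
       (\<exists>c. \<forall>x>0. f\<^sub>1 x = f\<^sub>2 x + c)) \<and>
    (\<forall>f. admissible_solution p g f \<longrightarrow>
       (\<forall>x>0. convergent (\<lambda>n. f_seq p n g x) \<and> f x = f 1 + lim (\<lambda>n. f_seq p n g x)) \<and>
       (\<forall>I. is_interval I \<longrightarrow> I \<subseteq> {0<..} \<longrightarrow> \<not> bounded I \<longrightarrow>
          (p_concave_on (int p) I g \<longrightarrow> p_convex_on (int p) I f) \<and>
          (p_convex_on (int p) I g \<longrightarrow> p_concave_on (int p) I f)))"
proof (intro conjI allI impI)
  show "\<exists>f. admissible_solution p g f"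
    using limit_f_seq_admissible[OF assms, of "\<lambda>x. lim (\<lambda>n. f_seq p n g x)"]
      convergent_f_seq[OF assms] by (auto simp: convergent_LIMSEQ_iff)
next
  fix f\<^sub>1 f\<^sub>2 assume sol: "admissible_solution p g f\<^sub>1" "admissible_solution p g f\<^sub>2"
  have "f\<^sub>1 x = f\<^sub>2 x + (f\<^sub>1 1 - f\<^sub>2 1)" if "x > 0" for x
    using LIMSEQ_unique[OF f_seq_tendsto_solution[OF sol(1) assms(2) that]
        f_seq_tendsto_solution[OF sol(2) assms(2) that]] by simp
  then show "\<exists>c. \<forall>x>0. f\<^sub>1 x = f\<^sub>2 x + c"
    by blast
next
  fix f and x :: real assume f: "admissible_solution p g f" and x: "x > 0"
  show "convergent (\<lambda>n. f_seq p n g x)"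
    by (rule convergent_f_seq[OF assms x])
  show "f x = f 1 + lim (\<lambda>n. f_seq p n g x)"
    using limI[OF f_seq_tendsto_solution[OF f assms(2) x]] by simp
next
  fix f and I :: "real set" assume f: "admissible_solution p g f"
    and I: "is_interval I" "I \<subseteq> {0<..}" "\<not> bounded I"
  let ?h = "\<lambda>x. f x - f 1"
  have closed: "x + real k \<in> I" if "x \<in> I" for x :: real and k
    using unbounded_interval_closed_under_shift[OF I that] .
  have lim: "(\<lambda>n. f_seq p n g x) \<longlonglongrightarrow> ?h x" if "x \<in> I" for x
    using f_seq_tendsto_solution[OF f assms(2)] that I(2) by auto
  have h: "dd ?h S = dd f S" if "finite S" "card S = p + 2" for S
    using that by (simp add: dd_diff dd_const)
  show "p_convex_on (int p) I f" if "p_concave_on (int p) I g"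
    using p_convex_on_limit_f_seq[OF closed lim that] h by (simp add: p_convex_on_iff_dd)
  show "p_concave_on (int p) I f" if "p_convex_on (int p) I g"
    using p_concave_on_limit_f_seq[OF closed lim that] h
    by (simp add: p_concave_on_iff_minus p_convex_on_iff_dd dd_minus del: minus_diff_eq)
qed

end
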